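(* Let $G=G_1*G_2$ be a free product of groups $G_1$ and $G_2$ such that $|G_1|\ge 3$ and $|G_2|\ge 2$, and let $m\ge 0$ be an integer. Then $\mathrm{pw}_m(G,G_1\cup G_2)$ is infinite.
   Context: Let $G$ be a group with generating set $X$. A reduced word $w$ in the alphabet $X^{\pm1}$ is called a palindrome if it reads the same left-to-right and right-to-left. An element $g\in G$ is called a palindrome if there exists a word in $X^{\pm1}$ representing $g$ that is a palindrome. For an integer $m\ge 0$, an element $g\in G$ is an $m$-almost palindrome if some word in $X^{\pm1}$ representing $g$ differs from a palindrome by a change of at most $m$ letters in $X^{\pm1}$. $\mathcal{P}_m(X)$ denotes the set of all $m$-almost palindromes in $G$. The $m$-almost palindromic length $l_{\mathcal{P}_m}(g)$ of $g\in G$ is the minimum $k$ such that $g=p_1p_2\cdots p_k$ with each $p_i\in\mathcal{P}_m(X)$. The $m$-almost palindromic width of $G$ with respect to $X$ is $\mathrm{pw}_m(G,X)=\sup_{g\in G} l_{\mathcal{P}_m}(g)$. *)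

theory Defs
  imports "HOL-Algebra.Generated_Groups" "HOL-Library.Extended_Nat"
begin

section \<open>The free product of two groups\<close>

definition fp_words ::
    "('a, 'c) monoid_scheme \<Rightarrow> ('b, 'd) monoid_scheme \<Rightarrow> ('a + 'b) list set" where
  "fp_words A B = lists (carrier A <+> carrier B)"

inductive_set fp_rel ::
    "('a, 'c) monoid_scheme \<Rightarrow> ('b, 'd) monoid_scheme \<Rightarrow> (('a + 'b) list \<times> ('a + 'b) list) set"
  for A :: "('a, 'c) monoid_scheme" and B :: "('b, 'd) monoid_scheme" where
  refl: "w \<in> fp_words A B \<Longrightarrow> (w, w) \<in> fp_rel A B"
| sym: "(v, w) \<in> fp_rel A B \<Longrightarrow> (w, v) \<in> fp_rel A B"
| trans: "(u, v) \<in> fp_rel A B \<Longrightarrow> (v, w) \<in> fp_rel A B \<Longrightarrow> (u, w) \<in> fp_rel A B"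
| oneL: "u \<in> fp_words A B \<Longrightarrow> v \<in> fp_words A B \<Longrightarrow>
    (u @ Inl \<one>\<^bsub>A\<^esub> # v, u @ v) \<in> fp_rel A B"
| oneR: "u \<in> fp_words A B \<Longrightarrow> v \<in> fp_words A B \<Longrightarrow>
    (u @ Inr \<one>\<^bsub>B\<^esub> # v, u @ v) \<in> fp_rel A B"
| multL: "u \<in> fp_words A B \<Longrightarrow> v \<in> fp_words A B \<Longrightarrow> x \<in> carrier A \<Longrightarrow> y \<in> carrier A \<Longrightarrow>
    (u @ Inl x # Inl y # v, u @ Inl (x \<otimes>\<^bsub>A\<^esub> y) # v) \<in> fp_rel A B"
| multR: "u \<in> fp_words A B \<Longrightarrow> v \<in> fp_words A B \<Longrightarrow> x \<in> carrier B \<Longrightarrow> y \<in> carrier B \<Longrightarrow>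
    (u @ Inr x # Inr y # v, u @ Inr (x \<otimes>\<^bsub>B\<^esub> y) # v) \<in> fp_rel A B"

definition free_product ::
    "('a, 'c) monoid_scheme \<Rightarrow> ('b, 'd) monoid_scheme \<Rightarrow> ('a + 'b) list set monoid" where
  "free_product A B =
    \<lparr>carrier = fp_words A B // fp_rel A B,
     monoid.mult = (\<lambda>P Q. \<Union>p\<in>P. \<Union>q\<in>Q. fp_rel A B `` {p @ q}),
     monoid.one = fp_rel A B `` {[]}\<rparr>"

definition fp_left ::
    "('a, 'c) monoid_scheme \<Rightarrow> ('b, 'd) monoid_scheme \<Rightarrow> 'a \<Rightarrow> ('a + 'b) list set" where
  "fp_left A B x = fp_rel A B `` {[Inl x]}"

definition fp_right ::
    "('a, 'c) monoid_scheme \<Rightarrow> ('b, 'd) monoid_scheme \<Rightarrow> 'b \<Rightarrow> ('a + 'b) list set" where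
  "fp_right A B y = fp_rel A B `` {[Inr y]}"


text \<open>The construction is a group, generated by the images of the factors, and it has the universal
  property of the coproduct. Taking one factor as the target shows that the factors embed.\<close>

lemma fp_rel_words: "(v, w) \<in> fp_rel A B \<Longrightarrow> group A \<Longrightarrow> group B \<Longrightarrow> v \<in> fp_words A B \<and> w \<in> fp_words A B"
  by (induction rule: fp_rel.induct)
     (auto simp: fp_words_def group.is_monoid monoid.m_closed monoid.one_closed)

lemma fp_rel_equiv:
  assumes "group A" "group B"
  shows "equiv (fp_words A B) (fp_rel A B)"
proof (rule equivI)
  show "fp_rel A B \<subseteq> fp_words A B \<times> fp_words A B"
    using fp_rel_words assms by fast
  show "refl_on (fp_words A B) (fp_rel A B)"
    by (auto intro!: refl_onI fp_rel.refl)
  show "sym (fp_rel A B)" by (auto intro!: symI fp_rel.sym)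
  show "trans (fp_rel A B)" by (blast intro: transI fp_rel.trans)
qed

lemma fp_rel_context:
  assumes "(v, w) \<in> fp_rel A B" "s \<in> fp_words A B" "t \<in> fp_words A B"
  shows "(s @ v @ t, s @ w @ t) \<in> fp_rel A B"
  using assms
proof (induction rule: fp_rel.induct)
  case (refl w) then show ?case by (auto intro!: fp_rel.refl simp: fp_words_def)
next
  case (sym v w) then show ?case by (blast intro: fp_rel.sym)
next
  case (trans u v w) then show ?case by (blast intro: fp_rel.trans)
next
  case (oneL u v) then show ?case
    using fp_rel.oneL[of "s @ u" A B "v @ t"] by (simp add: fp_words_def)
next
  case (oneR u v) then show ?case
    using fp_rel.oneR[of "s @ u" A B "v @ t"] by (simp add: fp_words_def)
next
  case (multL u v x y) then show ?case
    using fp_rel.multL[of "s @ u" A B "v @ t" x y] by (simp add: fp_words_def)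
next
  case (multR u v x y) then show ?case
    using fp_rel.multR[of "s @ u" A B "v @ t" x y] by (simp add: fp_words_def)
qed

lemma fp_rel_append:
  assumes "group A" "group B" "(v, v') \<in> fp_rel A B" "(w, w') \<in> fp_rel A B"
  shows "(v @ w, v' @ w') \<in> fp_rel A B"
proof -
  have "[] \<in> fp_words A B" by (simp add: fp_words_def)
  then have "(v @ w, v' @ w) \<in> fp_rel A B" "(v' @ w, v' @ w') \<in> fp_rel A B"
    using fp_rel_context[OF assms(3), of "[]" w] fp_rel_context[OF assms(4), of v' "[]"]
      fp_rel_words[OF assms(3,1,2)] fp_rel_words[OF assms(4,1,2)] by auto
  then show ?thesis by (rule fp_rel.trans)
qed

lemma fp_mult_class:
  assumes "group A" "group B" "v \<in> fp_words A B" "w \<in> fp_words A B"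
  shows "fp_rel A B `` {v} \<otimes>\<^bsub>free_product A B\<^esub> fp_rel A B `` {w} = fp_rel A B `` {v @ w}"
proof -
  have "fp_rel A B `` {p @ q} = fp_rel A B `` {v @ w}"
    if "(v, p) \<in> fp_rel A B" "(w, q) \<in> fp_rel A B" for p q
    using equiv_class_eq[OF fp_rel_equiv[OF assms(1,2)] fp_rel_append[OF assms(1,2) that]] by simp
  then have "(\<Union>p \<in> fp_rel A B `` {v}. \<Union>q \<in> fp_rel A B `` {w}. fp_rel A B `` {p @ q}) =
      (\<Union>p \<in> fp_rel A B `` {v}. \<Union>q \<in> fp_rel A B `` {w}. fp_rel A B `` {v @ w})"
    by (intro SUP_cong HOL.refl) (simp add: Image_singleton_iff)
  moreover have "fp_rel A B `` {v} \<noteq> {}" "fp_rel A B `` {w} \<noteq> {}"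
    using assms(3,4)[THEN fp_rel.refl] by blast+
  ultimately show ?thesis by (simp only: free_product_def monoid.simps UN_constant if_False)
qed

lemma fp_class_carrier: "w \<in> fp_words A B \<Longrightarrow> fp_rel A B `` {w} \<in> carrier (free_product A B)"
  by (simp add: free_product_def quotientI)

lemma fp_carrierE:
  assumes "P \<in> carrier (free_product A B)"
  obtains w where "w \<in> fp_words A B" "P = fp_rel A B `` {w}"
  using assms by (auto simp: free_product_def elim: quotientE)

lemma fp_inv_word:
  assumes "group A" "group B" "w \<in> fp_words A B"
  shows "\<exists>v \<in> fp_words A B. (v @ w, []) \<in> fp_rel A B"
  using assms(3)
proof (induction w)
  case Nil
  then show ?case by (intro bexI[of _ "[]"]) (auto intro: fp_rel.refl)
next
  case (Cons z w)
  interpret A: group A by fact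
  interpret B: group B by fact
  from Cons obtain v where v: "v \<in> fp_words A B" "(v @ w, []) \<in> fp_rel A B"
    and w: "w \<in> fp_words A B" and z: "z \<in> carrier A <+> carrier B"
    by (auto simp: fp_words_def)
  obtain y where y: "y \<in> carrier A <+> carrier B" "(v @ y # z # w, v @ w) \<in> fp_rel A B"
  proof (cases z)
    case (Inl x)
    then show ?thesis
      using that[of "Inl (inv\<^bsub>A\<^esub> x)"] z fp_rel.multL[OF v(1) w, of "inv\<^bsub>A\<^esub> x" x] fp_rel.oneL[OF v(1) w]
      by (auto intro: fp_rel.trans)
  next
    case (Inr x)
    then show ?thesis
      using that[of "Inr (inv\<^bsub>B\<^esub> x)"] z fp_rel.multR[OF v(1) w, of "inv\<^bsub>B\<^esub> x" x] fp_rel.oneR[OF v(1) w]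
      by (auto intro: fp_rel.trans)
  qed
  then show ?case
    using v by (intro bexI[of _ "v @ [y]"]) (auto simp: fp_words_def intro: fp_rel.trans)
qed

lemma free_product_group:
  assumes "group A" "group B"
  shows "group (free_product A B)"
proof (rule groupI)
  have nil: "[] \<in> fp_words A B" by (simp add: fp_words_def)
  have one: "\<one>\<^bsub>free_product A B\<^esub> = fp_rel A B `` {[]}" by (simp add: free_product_def)
  have app: "v @ w \<in> fp_words A B" if "v \<in> fp_words A B" "w \<in> fp_words A B" for v w
    using that by (simp add: fp_words_def)
  note mult = fp_mult_class[OF assms]
  show "\<one>\<^bsub>free_product A B\<^esub> \<in> carrier (free_product A B)"
    by (simp add: one nil fp_class_carrier)
  fix P assume "P \<in> carrier (free_product A B)"
  then obtain u where u: "u \<in> fp_words A B" "P = fp_rel A B `` {u}" by (rule fp_carrierE)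
  show "\<one>\<^bsub>free_product A B\<^esub> \<otimes>\<^bsub>free_product A B\<^esub> P = P"
    by (simp add: one u mult nil)
  obtain v where v: "v \<in> fp_words A B" "(v @ u, []) \<in> fp_rel A B"
    using fp_inv_word[OF assms u(1)] by auto
  show "\<exists>Q\<in>carrier (free_product A B). Q \<otimes>\<^bsub>free_product A B\<^esub> P = \<one>\<^bsub>free_product A B\<^esub>"
    using v equiv_class_eq[OF fp_rel_equiv[OF assms] v(2)]
    by (intro bexI[of _ "fp_rel A B `` {v}"]) (simp_all add: one u mult fp_class_carrier)
  fix Q assume "Q \<in> carrier (free_product A B)"
  then obtain v where v: "v \<in> fp_words A B" "Q = fp_rel A B `` {v}" by (rule fp_carrierE)
  show "P \<otimes>\<^bsub>free_product A B\<^esub> Q \<in> carrier (free_product A B)"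
    by (simp add: u v mult app fp_class_carrier)
  fix R assume "R \<in> carrier (free_product A B)"
  then obtain w where w: "w \<in> fp_words A B" "R = fp_rel A B `` {w}" by (rule fp_carrierE)
  show "P \<otimes>\<^bsub>free_product A B\<^esub> Q \<otimes>\<^bsub>free_product A B\<^esub> R = P \<otimes>\<^bsub>free_product A B\<^esub> (Q \<otimes>\<^bsub>free_product A B\<^esub> R)"
    by (simp add: u v w mult app)
qed

lemma fp_left_hom:
  assumes "group A" "group B"
  shows "fp_left A B \<in> hom A (free_product A B)"
proof (rule homI)
  interpret A: group A by fact
  fix x y assume xy: "x \<in> carrier A" "y \<in> carrier A"
  then show "fp_left A B x \<in> carrier (free_product A B)"
    by (auto simp: fp_left_def fp_words_def intro!: fp_class_carrier)
  have e: "([Inl x, Inl y], [Inl (x \<otimes>\<^bsub>A\<^esub> y)]) \<in> fp_rel A B"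
    using fp_rel.multL[of "[]" A B "[]" x y] xy by (simp add: fp_words_def)
  show "fp_left A B (x \<otimes>\<^bsub>A\<^esub> y) = fp_left A B x \<otimes>\<^bsub>free_product A B\<^esub> fp_left A B y"
    using fp_mult_class[OF assms, of "[Inl x]" "[Inl y]"] equiv_class_eq[OF fp_rel_equiv[OF assms] e]
    xy by (simp add: fp_left_def fp_words_def InlI)
qed

lemma fp_right_hom:
  assumes "group A" "group B"
  shows "fp_right A B \<in> hom B (free_product A B)"
proof (rule homI)
  interpret B: group B by fact
  fix x y assume xy: "x \<in> carrier B" "y \<in> carrier B"
  then show "fp_right A B x \<in> carrier (free_product A B)"
    by (auto simp: fp_right_def fp_words_def intro!: fp_class_carrier)
  have e: "([Inr x, Inr y], [Inr (x \<otimes>\<^bsub>B\<^esub> y)]) \<in> fp_rel A B"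
    using fp_rel.multR[of "[]" A B "[]" x y] xy by (simp add: fp_words_def)
  show "fp_right A B (x \<otimes>\<^bsub>B\<^esub> y) = fp_right A B x \<otimes>\<^bsub>free_product A B\<^esub> fp_right A B y"
    using fp_mult_class[OF assms, of "[Inr x]" "[Inr y]"] equiv_class_eq[OF fp_rel_equiv[OF assms] e]
    xy by (simp add: fp_right_def fp_words_def InrI)
qed

lemma fp_generate:
  assumes "group A" "group B"
  shows "generate (free_product A B) (fp_left A B ` carrier A \<union> fp_right A B ` carrier B)
    = carrier (free_product A B)" (is "generate ?F ?X = _")
proof
  interpret F: group ?F using assms by (rule free_product_group)
  show "generate ?F ?X \<subseteq> carrier ?F"
    using fp_left_hom[OF assms] fp_right_hom[OF assms]
    by (intro F.generate_incl) (auto simp: hom_def)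
  have "fp_rel A B `` {w} \<in> generate ?F ?X" if "w \<in> fp_words A B" for w
    using that
  proof (induction w)
    case Nil
    then show ?case using generate.one[of ?F ?X] by (simp add: free_product_def)
  next
    case (Cons z w)
    then have w: "w \<in> fp_words A B" and z: "[z] \<in> fp_words A B" by (auto simp: fp_words_def)
    have "fp_rel A B `` {[z]} \<in> ?X"
      using z by (cases z) (auto simp: fp_words_def fp_left_def fp_right_def)
    then have "fp_rel A B `` {[z]} \<otimes>\<^bsub>?F\<^esub> fp_rel A B `` {w} \<in> generate ?F ?X"
      using Cons.IH[OF w] by (blast intro: generate.eng generate.incl)
    then show ?case by (simp add: fp_mult_class[OF assms z w])
  qed
  then show "carrier ?F \<subseteq> generate ?F ?X" by (auto elim: fp_carrierE)
qed

lemma fp_universal: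
  assumes "group A" "group B" "group K" and f: "f \<in> hom A K" and g: "g \<in> hom B K"
  shows "\<exists>h \<in> hom (free_product A B) K.
    (\<forall>x \<in> carrier A. h (fp_left A B x) = f x) \<and> (\<forall>y \<in> carrier B. h (fp_right A B y) = g y)"
proof -
  interpret A: group A by fact
  interpret B: group B by fact
  interpret K: group K by fact
  interpret f: group_hom A K f by unfold_locales (rule f)
  interpret g: group_hom B K g by unfold_locales (rule g)
  define val where "val w = foldr (\<lambda>z k. case_sum f g z \<otimes>\<^bsub>K\<^esub> k) w \<one>\<^bsub>K\<^esub>" for w
  have closed: "val w \<in> carrier K" if "w \<in> fp_words A B" for w
    using that unfolding fp_words_def by (induction w) (auto simp: val_def)
  have app: "val (v @ w) = val v \<otimes>\<^bsub>K\<^esub> val w" if "v \<in> fp_words A B" "w \<in> fp_words A B" for v w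
    using that(1)
  proof (induction v)
    case Nil then show ?case using closed[OF that(2)] by (simp add: val_def)
  next
    case (Cons z v)
    then have v: "v \<in> fp_words A B" and z: "z \<in> carrier A <+> carrier B" by (auto simp: fp_words_def)
    have "case_sum f g z \<in> carrier K" using z by auto
    then show ?case using Cons.IH[OF v] closed[OF v] closed[OF that(2)]
      by (simp add: val_def K.m_assoc)
  qed
  have resp: "val v = val w" if "(v, w) \<in> fp_rel A B" for v w
    using that
  proof (induction rule: fp_rel.induct)
    case (oneL u v)
    have "Inl \<one>\<^bsub>A\<^esub> # v \<in> fp_words A B" using oneL by (auto simp: fp_words_def)
    then show ?case using oneL closed[OF oneL(2)] by (simp add: app) (simp add: val_def)
  next
    case (oneR u v)
    have "Inr \<one>\<^bsub>B\<^esub> # v \<in> fp_words A B" using oneR by (auto simp: fp_words_def)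
    then show ?case using oneR closed[OF oneR(2)] by (simp add: app) (simp add: val_def)
  next
    case (multL u v x y)
    have "Inl x # Inl y # v \<in> fp_words A B" "Inl (x \<otimes>\<^bsub>A\<^esub> y) # v \<in> fp_words A B"
      using multL by (auto simp: fp_words_def)
    then show ?case using multL closed[OF multL(2)] by (simp add: app) (simp add: val_def K.m_assoc)
  next
    case (multR u v x y)
    have "Inr x # Inr y # v \<in> fp_words A B" "Inr (x \<otimes>\<^bsub>B\<^esub> y) # v \<in> fp_words A B"
      using multR by (auto simp: fp_words_def)
    then show ?case using multR closed[OF multR(2)] by (simp add: app) (simp add: val_def K.m_assoc)
  qed auto
  define h where "h P = val (SOME w. w \<in> P)" for P
  have h: "h (fp_rel A B `` {w}) = val w" if "w \<in> fp_words A B" for w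
  proof -
    have "(SOME v. v \<in> fp_rel A B `` {w}) \<in> fp_rel A B `` {w}"
      by (rule someI[of _ w]) (simp add: that fp_rel.refl)
    then show ?thesis unfolding h_def using resp by auto
  qed
  have "h \<in> hom (free_product A B) K"
  proof (rule homI)
    fix P assume "P \<in> carrier (free_product A B)"
    then obtain v where v: "v \<in> fp_words A B" "P = fp_rel A B `` {v}" by (rule fp_carrierE)
    then show "h P \<in> carrier K" by (simp add: h closed)
    fix Q assume "Q \<in> carrier (free_product A B)"
    then obtain w where w: "w \<in> fp_words A B" "Q = fp_rel A B `` {w}" by (rule fp_carrierE)
    have "v @ w \<in> fp_words A B" using v w by (simp add: fp_words_def)
    then show "h (P \<otimes>\<^bsub>free_product A B\<^esub> Q) = h P \<otimes>\<^bsub>K\<^esub> h Q"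
      using v w by (simp add: fp_mult_class[OF assms(1,2)] h app)
  qed
  moreover have "h (fp_left A B x) = f x" if "x \<in> carrier A" for x
    using that h[of "[Inl x]"] by (simp add: fp_left_def fp_words_def InlI val_def)
  moreover have "h (fp_right A B y) = g y" if "y \<in> carrier B" for y
    using that h[of "[Inr y]"] by (simp add: fp_right_def fp_words_def InrI val_def)
  ultimately show ?thesis by blast
qed


section \<open>Almost palindromes\<close>

definition word_val :: "('g, 'e) monoid_scheme \<Rightarrow> 'g list \<Rightarrow> 'g" where
  "word_val G w = foldr (\<otimes>\<^bsub>G\<^esub>) w \<one>\<^bsub>G\<^esub>"

text \<open>Letters are elements of the group, so \<open>X\<^sup>\<plusminus>\<^sup>1\<close> is a subset of the carrier.\<close>

definition sym_alphabet :: "('g, 'e) monoid_scheme \<Rightarrow> 'g set \<Rightarrow> 'g set" where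
  "sym_alphabet G X = X \<union> (\<lambda>x. inv\<^bsub>G\<^esub> x) ` X"

text \<open>Reduced words for a free product with factors \<open>H\<close> and \<open>K\<close> (as subgroups of \<open>G\<close>): all letters
  are nontrivial and neighbouring letters lie in different factors. Mere free reducedness over the
  alphabet would not do: if both factors are perfect, every element is the value of a freely
  reduced word over \<open>H \<union> K\<close> that coincides with its reverse, because then \<open>1\<close> and an arbitrary
  element of a factor are values of a word and of its reverse.\<close>

definition fp_reduced_words :: "('g, 'e) monoid_scheme \<Rightarrow> 'g set \<Rightarrow> 'g set \<Rightarrow> 'g list set" where
  "fp_reduced_words G H K =
    {w. set w \<subseteq> (H \<union> K) - {\<one>\<^bsub>G\<^esub>} \<and>
        successively (\<lambda>x y. \<not> (x \<in> H \<and> y \<in> H) \<and> \<not> (x \<in> K \<and> y \<in> K)) w}"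

text \<open>Below, \<open>R\<close> is the set of words regarded as reduced; palindromes are reduced by definition,
  whereas the word representing an almost palindrome need not be.\<close>

definition palindrome_words :: "('g, 'e) monoid_scheme \<Rightarrow> 'g set \<Rightarrow> 'g list set \<Rightarrow> 'g list set" where
  "palindrome_words G X R = {w \<in> lists (sym_alphabet G X). w \<in> R \<and> rev w = w}"

definition almost_palindromes ::
    "nat \<Rightarrow> ('g, 'e) monoid_scheme \<Rightarrow> 'g set \<Rightarrow> 'g list set \<Rightarrow> 'g set" where
  "almost_palindromes m G X R =
    {g \<in> carrier G. \<exists>w \<in> lists (sym_alphabet G X). word_val G w = g \<and>
       (\<exists>p \<in> palindrome_words G X R.
          length p = length w \<and> card {i. i < length w \<and> w ! i \<noteq> p ! i} \<le> m)}"

definition almost_palindromic_length ::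
    "nat \<Rightarrow> ('g, 'e) monoid_scheme \<Rightarrow> 'g set \<Rightarrow> 'g list set \<Rightarrow> 'g \<Rightarrow> enat" where
  "almost_palindromic_length m G X R g =
    (INF ps \<in> {ps \<in> lists (almost_palindromes m G X R). word_val G ps = g}. enat (length ps))"

definition almost_palindromic_width ::
    "nat \<Rightarrow> ('g, 'e) monoid_scheme \<Rightarrow> 'g set \<Rightarrow> 'g list set \<Rightarrow> enat" where
  "almost_palindromic_width m G X R =
    (SUP g \<in> carrier G. almost_palindromic_length m G X R g)"

end

theory Submission
  imports Defs "HOL-Library.Sublist"
begin

text \<open>The idea is to find an integer-valued quasimorphism on the free product that vanishes on
  palindromes and on letters. Changing one letter of a word then changes the value by a bounded
  amount, so a product of \<open>k\<close> almost palindromes has value at most linear in \<open>k\<close>, and unboundedness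
  of the quasimorphism suffices.

  Brooks' counting quasimorphisms have to be adapted, since a function on reduced words must be odd
  under inversion to be a quasimorphism and odd under reversal to vanish on palindromes. Choose
  distinct nontrivial \<open>a\<close>, \<open>c\<close> in the factor of order at least 3, either mutually inverse or both
  involutions. Record only the letters of that factor, with sign \<open>+\<close> for \<open>a\<close>, \<open>-\<close> for \<open>c\<close> and \<open>0\<close>
  otherwise. Inversion acts on such sign sequences by reversal, combined in the first case with a
  change of all signs. Thus a count that is odd under reversal and even under sign change serves
  both cases. It is unbounded if it counts a pattern \<open>s\<close> such that no power of \<open>s\<close> contains the
  reverse of \<open>s\<close> or its negative.\<close>

section \<open>Counting a chiral pattern\<close>

fun occurrences :: "'x list \<Rightarrow> 'x list \<Rightarrow> int" where
  "occurrences s [] = 0"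
| "occurrences s (x # w) = of_bool (prefix s (x # w)) + occurrences s w"

lemma occurrences_nonneg: "0 \<le> occurrences s w"
  by (induction w) auto

lemma occurrences_short: "length w < length s \<Longrightarrow> occurrences s w = 0"
  by (induction w) (auto dest: prefix_length_le)

text \<open>Splitting loses only occurrences that start in \<open>u\<close> and run into
  \<open>v\<close>. The \<open>min\<close> carries the induction: the bound grows while
  \<open>u\<close> is shorter than \<open>s\<close>; after that, a new first letter starts no
  crossing occurrence.\<close>

lemma occurrences_append:
  "occurrences s u + occurrences s v \<le> occurrences s (u @ v)"
  "occurrences s (u @ v) \<le> occurrences s u + occurrences s v + int (min (length u) (length s))"
proof (induction u)
  case (Cons x u)
  { case 1 then show ?case using Cons(1) by (auto simp: of_bool_def) (metis append_Cons prefix_prefix)+ }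
  case 2
  show ?case
  proof (cases "length s \<le> length (x # u)")
    case True
    then have "prefix s (x # u @ v) \<longleftrightarrow> prefix s (x # u)"
      by (metis append_Cons prefix_length_prefix prefix_prefix prefixI)
    then show ?thesis using Cons(2) True by auto
  next
    case False
    then show ?thesis using Cons(2) by (auto simp: of_bool_def)
  qed
qed auto

text \<open>No cyclic binary word of length at most 5 differs from its reverse up to rotation, and at length
  6 the only ones equal their reverse with all signs changed. At odd length the latter is impossible.\<close>

definition pattern :: "int list" where
  "pattern = [1, 1, 1, -1, 1, -1, -1]"

definition pattern_count :: "int list \<Rightarrow> int" where
  "pattern_count w = occurrences pattern w + occurrences pattern (map uminus w)"

definition chirality :: "int list \<Rightarrow> int" where
  "chirality w = pattern_count w - pattern_count (rev w)"

lemma chirality_rev [simp]: "chirality (rev w) = - chirality w"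
  by (simp add: chirality_def)

lemma chirality_uminus [simp]: "chirality (map uminus w) = chirality w"
  by (simp add: chirality_def pattern_count_def rev_map comp_def)

text \<open>Two of the four counts enter positively and two negatively, each with a defect between 0
  and 7, the length of \<open>pattern\<close>; hence 14.\<close>

lemma chirality_append: "\<bar>chirality (u @ v) - chirality u - chirality v\<bar> \<le> 14"
  using occurrences_append[of pattern u v] occurrences_append[of pattern "rev v" "rev u"]
    occurrences_append[of pattern "map uminus u" "map uminus v"]
    occurrences_append[of pattern "map uminus (rev v)" "map uminus (rev u)"]
  by (simp add: chirality_def pattern_count_def pattern_def)

lemma chirality_short: "length w \<le> 1 \<Longrightarrow> chirality w = 0"
  by (simp add: chirality_def pattern_count_def occurrences_short pattern_def)

lemma chirality_pattern_power: "int n \<le> chirality (concat (replicate n pattern))"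
proof -
  have "int n \<le> occurrences pattern (concat (replicate n pattern))"
  proof (induction n)
    case (Suc n)
    have "occurrences pattern pattern = 1" by (simp add: pattern_def)
    then show ?case
      using Suc occurrences_append(1)[of pattern pattern "concat (replicate n pattern)"] by simp
  qed simp
  \<comment> \<open>An occurrence that starts in the first copy ends within the first two, so the
    induction keeps two copies unfolded.\<close>
  moreover have "occurrences pattern (concat (replicate n (rev pattern))) = 0"
    by (induction n rule: induct_nat_012) (simp_all add: pattern_def)
  moreover have "occurrences pattern (concat (replicate n (map uminus (rev pattern)))) = 0"
    by (induction n rule: induct_nat_012) (simp_all add: pattern_def)
  ultimately show ?thesis
    using occurrences_nonneg[of pattern "map uminus (concat (replicate n pattern))"]
    by (simp add: chirality_def pattern_count_def rev_concat map_concat)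
qed

section \<open>Normal forms in a free product\<close>

locale two_groups = A: group A + B: group B
  for A :: "('a, 'c) monoid_scheme" and B :: "('b, 'd) monoid_scheme"
begin

abbreviation letters :: "('a + 'b) set" where
  "letters \<equiv> carrier A <+> carrier B"

text \<open>The last clause is a default for letters of different factors; it lets
  \<open>isl_lmul\<close> hold without a side condition.\<close>

fun lmul :: "'a + 'b \<Rightarrow> 'a + 'b \<Rightarrow> 'a + 'b" where
  "lmul (Inl x) (Inl y) = Inl (x \<otimes>\<^bsub>A\<^esub> y)"
| "lmul (Inr x) (Inr y) = Inr (x \<otimes>\<^bsub>B\<^esub> y)"
| "lmul x y = x"

fun linv :: "'a + 'b \<Rightarrow> 'a + 'b" where
  "linv (Inl x) = Inl (inv\<^bsub>A\<^esub> x)"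
| "linv (Inr x) = Inr (inv\<^bsub>B\<^esub> x)"

fun trivial :: "'a + 'b \<Rightarrow> bool" where
  "trivial (Inl x) \<longleftrightarrow> x = \<one>\<^bsub>A\<^esub>"
| "trivial (Inr x) \<longleftrightarrow> x = \<one>\<^bsub>B\<^esub>"

lemma isl_lmul [simp]: "isl (lmul x y) = isl x"
  by (cases x; cases y) auto

lemma lmul_closed [simp]: "x \<in> letters \<Longrightarrow> y \<in> letters \<Longrightarrow> lmul x y \<in> letters"
  by (cases x; cases y) auto

lemma lmul_assoc:
  "x \<in> letters \<Longrightarrow> y \<in> letters \<Longrightarrow> z \<in> letters \<Longrightarrow> isl x = isl y \<Longrightarrow> isl y = isl z \<Longrightarrow>
    lmul (lmul x y) z = lmul x (lmul y z)"
  by (cases x; cases y; cases z) (auto simp: A.m_assoc B.m_assoc)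

lemma lmul_trivial_left: "trivial x \<Longrightarrow> y \<in> letters \<Longrightarrow> isl x = isl y \<Longrightarrow> lmul x y = y"
  by (cases x; cases y) auto

lemma lmul_trivial_right: "trivial y \<Longrightarrow> x \<in> letters \<Longrightarrow> isl x = isl y \<Longrightarrow> lmul x y = x"
  by (cases x; cases y) auto

lemma lmul_eq_trivial:
  "trivial (lmul x y) \<Longrightarrow> x \<in> letters \<Longrightarrow> y \<in> letters \<Longrightarrow> isl x = isl y \<Longrightarrow> y = linv x"
  by (cases x; cases y) (auto intro: A.inv_equality[symmetric] B.inv_equality[symmetric]
      simp: A.inv_comm B.inv_comm)

section \<open>Reduced words and van der Waerden's action of the letters on them\<close>

definition reduced :: "('a + 'b) list \<Rightarrow> bool" where
  "reduced w \<longleftrightarrow> set w \<subseteq> {x \<in> letters. \<not> trivial x} \<and> successively (\<lambda>x y. isl x \<noteq> isl y) w"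

lemma reduced_Nil [simp]: "reduced []"
  by (simp add: reduced_def)

lemma reduced_Cons:
  "reduced (x # w) \<longleftrightarrow>
    x \<in> letters \<and> \<not> trivial x \<and> reduced w \<and> (w = [] \<or> isl (hd w) \<noteq> isl x)"
  by (auto simp: reduced_def successively_Cons)

lemma reduced_append:
  "reduced (v @ w) \<longleftrightarrow>
    reduced v \<and> reduced w \<and> (v = [] \<or> w = [] \<or> isl (last v) \<noteq> isl (hd w))"
  by (auto simp: reduced_def successively_append_iff)

lemma reduced_letters: "reduced w \<Longrightarrow> set w \<subseteq> letters"
  by (auto simp: reduced_def)

definition push :: "'a + 'b \<Rightarrow> ('a + 'b) list \<Rightarrow> ('a + 'b) list" where
  "push x w = (if trivial x then w else x # w)"

fun act :: "'a + 'b \<Rightarrow> ('a + 'b) list \<Rightarrow> ('a + 'b) list" where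
  "act x [] = push x []"
| "act x (y # w) = (if isl y = isl x then push (lmul x y) w else push x (y # w))"

lemma act_push: "w = [] \<or> isl (hd w) \<noteq> isl x \<Longrightarrow> act x w = push x w"
  by (cases w) auto

lemma reduced_act: "x \<in> letters \<Longrightarrow> reduced w \<Longrightarrow> reduced (act x w)"
  by (cases w) (auto simp: push_def reduced_Cons)

lemma act_trivial: "trivial x \<Longrightarrow> reduced w \<Longrightarrow> act x w = w"
  by (cases w) (auto simp: push_def reduced_Cons lmul_trivial_left)

text \<open>Together with \<open>act_trivial\<close>, these are the defining relations of the free
  product, so \<open>nf\<close> is constant on classes. If \<open>y\<close> merges with the head of
  \<open>w\<close>, the letter after it lies in the other factor, and associativity settles the
  rest.\<close>

lemma act_lmul:
  assumes "x \<in> letters" "y \<in> letters" "isl x = isl y" "reduced w"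
  shows "act x (act y w) = act (lmul x y) w"
proof (cases "w = [] \<or> isl (hd w) \<noteq> isl y")
  case True
  then show ?thesis
    using assms by (auto simp: act_push push_def lmul_trivial_right)
next
  case False
  then obtain z v where w: "w = z # v" "isl z = isl y" by (cases w) auto
  with assms have v: "v = [] \<or> isl (hd v) \<noteq> isl x" and z: "z \<in> letters"
    by (auto simp: reduced_Cons)
  have "lmul (lmul x y) z = lmul x (lmul y z)" using assms w z by (simp add: lmul_assoc)
  then show ?thesis
    using assms w v z by (auto simp: act_push push_def lmul_trivial_right)
qed

definition nf :: "('a + 'b) list \<Rightarrow> ('a + 'b) list" where
  "nf w = foldr act w []"

lemma nf_append: "nf (v @ w) = foldr act v (nf w)"
  by (simp add: nf_def)

lemma reduced_nf: "w \<in> fp_words A B \<Longrightarrow> reduced (nf w)"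
  unfolding fp_words_def by (induction w) (auto simp: nf_def reduced_act)

lemma foldr_act_reduced: "reduced (v @ w) \<Longrightarrow> foldr act v w = v @ w"
proof (induction v)
  case (Cons x v)
  then show ?case by (auto simp: reduced_Cons act_push push_def)
qed simp

lemma nf_reduced: "reduced w \<Longrightarrow> nf w = w"
  using foldr_act_reduced[of w "[]"] by (simp add: nf_def)

lemma nf_fp_rel: "(v, w) \<in> fp_rel A B \<Longrightarrow> nf v = nf w"
proof (induction rule: fp_rel.induct)
  case (oneL u v)
  then show ?case by (simp add: nf_append nf_def[of "_ # _"] act_trivial reduced_nf flip: nf_def)
next
  case (oneR u v)
  then show ?case by (simp add: nf_append nf_def[of "_ # _"] act_trivial reduced_nf flip: nf_def)
next
  case (multL u v x y)
  then show ?case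
    using act_lmul[of "Inl x" "Inl y" "nf v"]
    by (simp add: nf_append nf_def[of "_ # _"] reduced_nf InlI flip: nf_def)
next
  case (multR u v x y)
  then show ?case
    using act_lmul[of "Inr x" "Inr y" "nf v"]
    by (simp add: nf_append nf_def[of "_ # _"] reduced_nf InrI flip: nf_def)
qed auto

lemma reduced_foldr_act: "set v \<subseteq> letters \<Longrightarrow> reduced w \<Longrightarrow> reduced (foldr act v w)"
  by (induction v) (auto intro: reduced_act)

lemma foldr_act_push:
  assumes "reduced (foldr act v w)"
  shows "foldr act (push x v) w = act x (foldr act v w)"
  using assms by (simp add: push_def act_trivial)

lemma foldr_act_act:
  assumes "x \<in> letters" "reduced v" "reduced w"
  shows "foldr act (act x v) w = act x (foldr act v w)"
proof (cases v)
  case (Cons y u)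
  then have y: "y \<in> letters" "set u \<subseteq> letters" using reduced_letters[OF assms(2)] by auto
  have r: "reduced (foldr act u w)" "reduced (foldr act (y # u) w)"
    using reduced_foldr_act[OF y(2) assms(3)] reduced_act[OF y(1)] by auto
  show ?thesis
    using Cons r act_lmul[OF assms(1) y(1) _ r(1)] by (auto simp: foldr_act_push)
qed (use assms in \<open>simp add: foldr_act_push\<close>)

text \<open>A left factor may be replaced by its normal form, so products in the group become
  products of reduced words.\<close>

lemma foldr_act_nf:
  assumes "v \<in> fp_words A B" "reduced w"
  shows "foldr act (nf v) w = foldr act v w"
  using assms(1)
proof (induction v)
  case (Cons x v)
  then have "v \<in> fp_words A B" "x \<in> letters" by (auto simp: fp_words_def)
  then show ?case
    using Cons.IH foldr_act_act[OF _ reduced_nf assms(2)] by (simp add: nf_def)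
qed (simp add: nf_def)

text \<open>A suffix \<open>q\<close> of \<open>u\<close> cancels against its inverse at the start
  of \<open>v\<close>; then the remainders are joined, or the two letters that meet merge. The
  induction removes the last letter of \<open>u\<close>, which is appended to \<open>q\<close> if it
  cancels.\<close>

lemma foldr_act_cases:
  assumes "reduced u" "reduced v"
  obtains (concat) p q r where "u = p @ q" "v = rev (map linv q) @ r" "foldr act u v = p @ r"
  | (merge) p x q y r where "u = p @ [x] @ q" "v = rev (map linv q) @ [y] @ r"
      "foldr act u v = p @ [lmul x y] @ r"
proof -
  have "(\<exists>p q r. u = p @ q \<and> v = rev (map linv q) @ r \<and> foldr act u v = p @ r) \<or>
    (\<exists>p x q y r. u = p @ [x] @ q \<and> v = rev (map linv q) @ [y] @ r \<and>
      foldr act u v = p @ [lmul x y] @ r)"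
    using assms
  proof (induction u arbitrary: v rule: rev_induct)
    case (snoc x u)
    show ?case
    proof (cases "reduced ((u @ [x]) @ v)")
      case True
      show ?thesis
        by (intro disjI1 exI[of _ "u @ [x]"] exI[of _ "[]"] exI[of _ v])
          (use foldr_act_reduced[OF True] in simp)
    next
      case False
      then have "v \<noteq> []" "isl (hd v) = isl x"
        using snoc.prems reduced_append[of "u @ [x]" v] by auto
      then obtain y w where v: "v = y # w" "isl y = isl x" by (cases v) auto
      have xy: "x \<in> letters" "y \<in> letters" "reduced u" "reduced w"
        using snoc.prems v by (auto simp: reduced_append reduced_Cons)
      show ?thesis
      proof (cases "trivial (lmul x y)")
        case True
        then have y: "y = linv x" using lmul_eq_trivial[OF True] xy v by simp
        have "foldr act (u @ [x]) v = foldr act u w"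
          using True v by (simp add: push_def)
        then show ?thesis
          using snoc.IH[OF xy(3,4)]
        proof (elim disjE exE conjE, goal_cases)
          case (1 p q r)
          then show ?thesis
            by (intro disjI1 exI[of _ p] exI[of _ "q @ [x]"] exI[of _ r]) (simp add: v y)
        next
          case (2 p x' q y' r)
          then show ?thesis
            by (intro disjI2 exI[of _ p] exI[of _ x'] exI[of _ "q @ [x]"] exI[of _ y'] exI[of _ r])
              (simp add: v y)
        qed
      next
        case False
        have "reduced (u @ lmul x y # w)"
          using snoc.prems False v xy by (auto simp: reduced_append reduced_Cons)
        then have "foldr act (u @ [x]) v = u @ [lmul x y] @ w"
          using False v foldr_act_reduced by (simp add: push_def)
        then show ?thesis
          by (intro disjI2 exI[of _ u] exI[of _ x] exI[of _ "[]"] exI[of _ y] exI[of _ w])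
            (simp add: v)
      qed
    qed
  qed simp
  then show thesis using concat merge by blast
qed

end

section \<open>A quasimorphism vanishing on palindromes\<close>

lemma card_mismatch_Cons:
  "card {i. i < length (x # v) \<and> (x # v) ! i \<noteq> (y # w) ! i}
    = of_bool (x \<noteq> y) + card {i. i < length v \<and> v ! i \<noteq> w ! i}"
proof -
  have "{i. i < length (x # v) \<and> (x # v) ! i \<noteq> (y # w) ! i}
      = (if x \<noteq> y then {0} else {}) \<union> Suc ` {i. i < length v \<and> v ! i \<noteq> w ! i}"
    by (auto simp: image_iff less_Suc_eq_0_disj nth_Cons')
  then show ?thesis by (auto simp: card_image card_insert_if)
qed

text \<open>The value -1 of \<open>eps\<close> serves a mutually inverse pair, the value 1 a pair of
  involutions, so that both cases share one argument.\<close>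

locale signed_two_groups = two_groups A B
  for A :: "('a, 'c) monoid_scheme" and B :: "('b, 'd) monoid_scheme" +
  fixes sign :: "'a \<Rightarrow> int" and eps :: int
  assumes eps: "eps = 1 \<or> eps = -1"
    and sign_inv: "x \<in> carrier A \<Longrightarrow> sign (inv\<^bsub>A\<^esub> x) = eps * sign x"
begin

definition signs :: "('a + 'b) list \<Rightarrow> int list" where
  "signs w = concat (map (case_sum (\<lambda>x. [sign x]) (\<lambda>_. [])) w)"

lemma signs_simps [simp]:
  "signs [] = []" "signs (Inl x # w) = sign x # signs w" "signs (Inr y # w) = signs w"
  "signs (v @ w) = signs v @ signs w"
  by (simp_all add: signs_def)

lemma length_signs_singleton: "length (signs [x]) \<le> 1"
  by (cases x) auto

lemma signs_rev: "signs (rev w) = rev (signs w)"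
proof (induction w)
  case (Cons x w)
  then show ?case by (cases x) auto
qed simp

lemma signs_linv: "set w \<subseteq> letters \<Longrightarrow> signs (map linv w) = map ((*) eps) (signs w)"
proof (induction w)
  case (Cons x w)
  then show ?case by (cases x) (auto simp: sign_inv)
qed simp

text \<open>Reversal changes the sign of \<open>chirality\<close>, and the factor \<open>eps\<close>
  leaves it unchanged.\<close>

lemma chirality_signs_inverse:
  assumes "set w \<subseteq> letters"
  shows "chirality (signs (rev (map linv w))) = - chirality (signs w)"
proof -
  have "chirality (map ((*) eps) l) = chirality l" for l
    using eps chirality_uminus[of l] by (auto cong: map_cong)
  then show ?thesis by (simp add: signs_rev signs_linv[OF assms])
qed

text \<open>In the worst case the defect 14 of \<^const>\<open>chirality\<close> enters six times.\<close>

lemma chirality_signs_foldr_act: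
  assumes "reduced u" "reduced v"
  shows "\<bar>chirality (signs (foldr act u v)) - chirality (signs u) - chirality (signs v)\<bar> \<le> 84"
  using assms
proof (cases rule: foldr_act_cases)
  case (concat p q r)
  have "set q \<subseteq> letters" using reduced_letters[OF assms(1)] concat by auto
  then have "chirality (signs (rev (map linv q))) = - chirality (signs q)"
    by (rule chirality_signs_inverse)
  then show ?thesis
    using concat chirality_append[of "signs p" "signs q"] chirality_append[of "signs p" "signs r"]
      chirality_append[of "signs (rev (map linv q))" "signs r"] by simp
next
  case (merge p x q y r)
  have "set q \<subseteq> letters" using reduced_letters[OF assms(1)] merge by auto
  then have "chirality (signs (rev (map linv q))) = - chirality (signs q)"
    by (rule chirality_signs_inverse)
  moreover have "chirality (signs [z]) = 0" for z
    using chirality_short length_signs_singleton by blast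
  ultimately show ?thesis
    using merge chirality_append[of "signs p" "signs [x] @ signs q"] chirality_append[of "signs [x]" "signs q"]
      chirality_append[of "signs (rev (map linv q))" "signs [y] @ signs r"]
      chirality_append[of "signs [y]" "signs r"]
      chirality_append[of "signs p" "signs [lmul x y] @ signs r"]
      chirality_append[of "signs [lmul x y]" "signs r"]
    by (simp only: signs_simps(4))
qed

section \<open>The quasimorphism on the free product\<close>

abbreviation "G \<equiv> free_product A B"
abbreviation "H1 \<equiv> fp_left A B ` carrier A"
abbreviation "H2 \<equiv> fp_right A B ` carrier B"

sublocale G: group G
  by (rule free_product_group) unfold_locales

text \<open>The chosen representative is immaterial, by \<open>nf_fp_rel\<close>.\<close>

definition Phi :: "('a + 'b) list set \<Rightarrow> int" where
  "Phi P = chirality (signs (nf (SOME w. w \<in> P)))"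

lemma Phi_class:
  assumes "w \<in> fp_words A B"
  shows "Phi (fp_rel A B `` {w}) = chirality (signs (nf w))"
proof -
  have "(SOME v. v \<in> fp_rel A B `` {w}) \<in> fp_rel A B `` {w}"
    by (rule someI[of _ w]) (simp add: assms fp_rel.refl)
  then show ?thesis unfolding Phi_def using nf_fp_rel by force
qed

lemma Phi_mult:
  assumes "P \<in> carrier G" "Q \<in> carrier G"
  shows "\<bar>Phi (P \<otimes>\<^bsub>G\<^esub> Q) - Phi P - Phi Q\<bar> \<le> 84"
proof -
  obtain v where v: "v \<in> fp_words A B" "P = fp_rel A B `` {v}" using assms(1) by (rule fp_carrierE)
  obtain w where w: "w \<in> fp_words A B" "Q = fp_rel A B `` {w}" using assms(2) by (rule fp_carrierE)
  have vw: "v @ w \<in> fp_words A B" using v w by (simp add: fp_words_def)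
  have "foldr act (nf v) (nf w) = nf (v @ w)"
    using foldr_act_nf[OF v(1) reduced_nf[OF w(1)]] by (simp add: nf_append)
  then show ?thesis
    using chirality_signs_foldr_act[of "nf v" "nf w"] v w vw
    by (simp add: fp_mult_class Phi_class reduced_nf A.is_group B.is_group)
qed

lemma Phi_letter:
  assumes "P \<in> H1 \<union> H2"
  shows "Phi P = 0"
proof -
  obtain x where x: "x \<in> letters" "P = fp_rel A B `` {[x]}"
    using assms by (auto simp: fp_left_def fp_right_def)
  have "length (signs (nf [x])) \<le> 1"
    using length_signs_singleton[of x] by (simp add: nf_def push_def)
  then show ?thesis
    using x by (simp add: Phi_class fp_words_def chirality_short)
qed

lemma factors_subset: "H1 \<union> H2 \<subseteq> carrier G"
  using fp_left_hom[of A B] fp_right_hom[of A B] A.is_group B.is_group by (auto simp: hom_def)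

lemma sym_alphabet_factors: "sym_alphabet G (H1 \<union> H2) = H1 \<union> H2"
proof -
  interpret L: group_hom A G "fp_left A B"
    by unfold_locales (rule fp_left_hom; rule A.is_group B.is_group)
  interpret R: group_hom B G "fp_right A B"
    by unfold_locales (rule fp_right_hom; rule A.is_group B.is_group)
  show ?thesis
    by (auto simp: sym_alphabet_def simp flip: L.hom_inv R.hom_inv)
qed

lemma word_val_closed: "set w \<subseteq> carrier G \<Longrightarrow> word_val G w \<in> carrier G"
  by (induction w) (auto simp: word_val_def)

lemma word_val_factors: "set w \<subseteq> H1 \<union> H2 \<Longrightarrow> word_val G w \<in> carrier G"
  using word_val_closed factors_subset by (meson subset_trans)

lemma word_val_classes:
  "w \<in> fp_words A B \<Longrightarrow> word_val G (map (\<lambda>z. fp_rel A B `` {[z]}) w) = fp_rel A B `` {w}"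
proof (induction w)
  case Nil
  then show ?case by (simp add: word_val_def free_product_def)
next
  case (Cons z w)
  then have "w \<in> fp_words A B" "[z] \<in> fp_words A B" by (auto simp: fp_words_def)
  then show ?case
    using Cons.IH fp_mult_class[of A B "[z]" w] A.is_group B.is_group by (simp add: word_val_def)
qed

text \<open>A reduced palindrome lifts letter by letter to a palindrome that is its own normal form.
  Its sign sequence equals its reverse, so the odd function \<open>chirality\<close> vanishes
  there.\<close>

lemma Phi_palindrome:
  assumes "p \<in> palindrome_words G (H1 \<union> H2) (fp_reduced_words G H1 H2)"
  shows "Phi (word_val G p) = 0"
proof -
  define cls where "cls z = fp_rel A B `` {[z]}" for z
  have p: "set p \<subseteq> H1 \<union> H2" "rev p = p" "\<one>\<^bsub>G\<^esub> \<notin> set p"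
    and alt: "successively (\<lambda>x y. \<not> (x \<in> H1 \<and> y \<in> H1) \<and> \<not> (x \<in> H2 \<and> y \<in> H2)) p"
    using assms sym_alphabet_factors by (auto simp: palindrome_words_def fp_reduced_words_def)
  have "\<forall>z \<in> H1 \<union> H2. \<exists>l \<in> letters. cls l = z"
    by (auto simp: cls_def fp_left_def fp_right_def)
  \<comment> \<open>One lift is fixed per group element, so equal letters get equal lifts and
    symmetry survives.\<close>
  then obtain letter where letter: "\<And>z. z \<in> H1 \<union> H2 \<Longrightarrow> letter z \<in> letters \<and> cls (letter z) = z"
    by metis
  have cls_factor: "if isl l then cls l \<in> H1 else cls l \<in> H2" if "l \<in> letters" for l
    using that by (auto simp: cls_def fp_left_def fp_right_def)
  have cls_trivial: "cls l = \<one>\<^bsub>G\<^esub>" if "l \<in> letters" "trivial l" for l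
  proof -
    interpret L: group_hom A G "fp_left A B"
      by unfold_locales (rule fp_left_hom; rule A.is_group B.is_group)
    interpret R: group_hom B G "fp_right A B"
      by unfold_locales (rule fp_right_hom; rule A.is_group B.is_group)
    show ?thesis
      using that L.hom_one R.hom_one by (cases l) (auto simp: cls_def fp_left_def fp_right_def)
  qed
  define q where "q = map letter p"
  have q: "map cls q = p" "set q \<subseteq> letters"
    using p letter by (auto simp: q_def intro!: map_idI)
  have "reduced q"
    unfolding reduced_def
  proof
    show "set q \<subseteq> {x \<in> letters. \<not> trivial x}"
      using q p(3) cls_trivial by (auto simp flip: q(1))
    \<comment> \<open>Lifts on the same side would put both neighbours into the same factor.\<close>
    have "successively (\<lambda>x y. isl (letter x) \<noteq> isl (letter y)) p"
    proof (rule successively_mono[OF alt])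
      fix x y
      assume "x \<in> set p" "y \<in> set p" and ne: "\<not> (x \<in> H1 \<and> y \<in> H1) \<and> \<not> (x \<in> H2 \<and> y \<in> H2)"
      then have "letter x \<in> letters" "cls (letter x) = x" "letter y \<in> letters" "cls (letter y) = y"
        using p(1) letter by blast+
      then show "isl (letter x) \<noteq> isl (letter y)"
        using cls_factor[of "letter x"] cls_factor[of "letter y"] ne by (auto split: if_splits)
    qed
    then show "successively (\<lambda>x y. isl x \<noteq> isl y) q"
      by (simp add: q_def successively_map)
  qed
  have words: "q \<in> fp_words A B" using q(2) by (auto simp: fp_words_def)
  have "rev q = q" using p(2) by (simp add: q_def rev_map)
  then have "rev (signs q) = signs q" by (simp flip: signs_rev)
  then have "chirality (signs q) = 0" using chirality_rev[of "signs q"] by simp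
  then show ?thesis
    using word_val_classes[OF words] Phi_class[OF words] nf_reduced[OF \<open>reduced q\<close>] q(1)
    by (simp add: cls_def[abs_def])
qed

text \<open>Letters are exchanged from left to right, and \<open>g\<close> collects those already
  treated. One exchange uses \<open>Phi_mult\<close> four times, twice for each product of
  \<open>g\<close>, a letter and the remaining word; letters have value 0, hence 336 = 4 *
  84.\<close>

lemma Phi_mismatch:
  assumes "length v = length w" "set v \<subseteq> H1 \<union> H2" "set w \<subseteq> H1 \<union> H2" "g \<in> carrier G"
  shows "\<bar>Phi (g \<otimes>\<^bsub>G\<^esub> word_val G v) - Phi (g \<otimes>\<^bsub>G\<^esub> word_val G w)\<bar>
    \<le> 336 * int (card {i. i < length v \<and> v ! i \<noteq> w ! i})"
  using assms
proof (induction v w arbitrary: g rule: list_induct2)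
  case (Cons x v y w)
  have xy: "x \<in> carrier G" "y \<in> carrier G" "Phi x = 0" "Phi y = 0"
    using Cons.prems factors_subset by (auto intro!: Phi_letter)
  have vw: "word_val G v \<in> carrier G" "word_val G w \<in> carrier G"
    using Cons.prems by (auto intro!: word_val_factors)
  have val: "g \<otimes>\<^bsub>G\<^esub> word_val G (x # v) = (g \<otimes>\<^bsub>G\<^esub> x) \<otimes>\<^bsub>G\<^esub> word_val G v"
    "g \<otimes>\<^bsub>G\<^esub> word_val G (y # w) = (g \<otimes>\<^bsub>G\<^esub> y) \<otimes>\<^bsub>G\<^esub> word_val G w"
    using xy vw Cons.prems by (simp_all add: word_val_def G.m_assoc)
  \<comment> \<open>Once \<open>x\<close> is exchanged for \<open>y\<close>, both words share the
    prefix ending in \<open>y\<close>.\<close>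
  have IH: "\<bar>Phi ((g \<otimes>\<^bsub>G\<^esub> y) \<otimes>\<^bsub>G\<^esub> word_val G v) - Phi ((g \<otimes>\<^bsub>G\<^esub> y) \<otimes>\<^bsub>G\<^esub> word_val G w)\<bar>
      \<le> 336 * int (card {i. i < length v \<and> v ! i \<noteq> w ! i})"
    using Cons.prems xy by (intro Cons.IH) auto
  have "\<bar>Phi ((g \<otimes>\<^bsub>G\<^esub> x) \<otimes>\<^bsub>G\<^esub> word_val G v) - Phi ((g \<otimes>\<^bsub>G\<^esub> y) \<otimes>\<^bsub>G\<^esub> word_val G v)\<bar>
      \<le> 336 * of_bool (x \<noteq> y)"
  proof (cases "x = y")
    case False
    then show ?thesis
      using Phi_mult[of "g \<otimes>\<^bsub>G\<^esub> x" "word_val G v"] Phi_mult[of "g \<otimes>\<^bsub>G\<^esub> y" "word_val G v"]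
        Phi_mult[of g x] Phi_mult[of g y] xy vw Cons.prems by simp
  qed simp
  then show ?case
    unfolding val card_mismatch_Cons using IH by simp
qed simp

lemma Phi_almost_palindrome:
  assumes "g \<in> almost_palindromes m G (H1 \<union> H2) (fp_reduced_words G H1 H2)"
  shows "\<bar>Phi g\<bar> \<le> 336 * int m"
proof -
  obtain w p where w: "set w \<subseteq> H1 \<union> H2" "word_val G w = g" "length p = length w"
    and p: "p \<in> palindrome_words G (H1 \<union> H2) (fp_reduced_words G H1 H2)"
    and diff: "card {i. i < length w \<and> w ! i \<noteq> p ! i} \<le> m"
    using assms unfolding almost_palindromes_def sym_alphabet_factors by blast
  have sp: "set p \<subseteq> H1 \<union> H2"
    using p sym_alphabet_factors by (auto simp: palindrome_words_def)
  have "word_val G w \<in> carrier G" "word_val G p \<in> carrier G"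
    using w(1) sp by (auto intro!: word_val_factors)
  then show ?thesis
    using Phi_mismatch[of w p "\<one>\<^bsub>G\<^esub>"] w(1-3) sp diff Phi_palindrome[OF p] by simp
qed

text \<open>Each factor contributes at most 336 * \<open>m\<close> by its own value and 84 by the
  multiplication that attaches it.\<close>

lemma Phi_product:
  assumes "ps \<in> lists (almost_palindromes m G (H1 \<union> H2) (fp_reduced_words G H1 H2))"
  shows "\<bar>Phi (word_val G ps)\<bar> \<le> int (length ps) * (336 * int m + 84)"
  using assms
proof (induction ps)
  case Nil
  have "Phi \<one>\<^bsub>G\<^esub> = 0"
    using Phi_class[of "[]"] chirality_short[of "[]"] by (simp add: free_product_def fp_words_def nf_def)
  then show ?case by (simp add: word_val_def)
next
  case (Cons g ps)
  have "set (g # ps) \<subseteq> carrier G"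
    using Cons by (auto simp: almost_palindromes_def)
  then have "g \<in> carrier G" "word_val G ps \<in> carrier G" by (auto intro!: word_val_closed)
  moreover have "\<bar>Phi g\<bar> \<le> 336 * int m" using Cons by (intro Phi_almost_palindrome) auto
  ultimately show ?case
    using Phi_mult[of g "word_val G ps"] Cons by (simp add: word_val_def algebra_simps)
qed

section \<open>From an unbounded quasimorphism to infinite width\<close>

lemma almost_palindromic_width_infinite:
  assumes unbounded: "\<And>n :: nat. \<exists>g \<in> carrier G. int n \<le> Phi g"
  shows "almost_palindromic_width m G (H1 \<union> H2) (fp_reduced_words G H1 H2) = \<infinity>"
proof (rule ccontr)
  let ?R = "fp_reduced_words G H1 H2"
  assume "almost_palindromic_width m G (H1 \<union> H2) ?R \<noteq> \<infinity>"
  then obtain k where k: "almost_palindromic_width m G (H1 \<union> H2) ?R = enat k" by auto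
  \<comment> \<open>The \<open>Suc\<close> puts the value strictly above the bound for
    \<open>k\<close> factors, so every factorization has more than \<open>k\<close>.\<close>
  obtain g where g: "g \<in> carrier G" "int (Suc (k * (336 * m + 84))) \<le> Phi g"
    using unbounded by blast
  have "enat (Suc k) \<le> almost_palindromic_length m G (H1 \<union> H2) ?R g"
    unfolding almost_palindromic_length_def
  proof (rule INF_greatest)
    fix ps assume "ps \<in> {ps \<in> lists (almost_palindromes m G (H1 \<union> H2) ?R). word_val G ps = g}"
    then have "Phi g \<le> int (length ps * (336 * m + 84))" using Phi_product[of ps m] by auto
    then have "k * (336 * m + 84) < length ps * (336 * m + 84)" using g(2) by linarith
    then show "enat (Suc k) \<le> enat (length ps)" by simp
  qed
  also have "\<dots> \<le> enat k"
    using SUP_upper[OF g(1), of "almost_palindromic_length m G (H1 \<union> H2) ?R"] k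
    by (simp add: almost_palindromic_width_def)
  finally show False by simp
qed

text \<open>Inserting \<open>b\<close> after each \<open>a\<close> or \<open>c\<close> makes the
  word reduced and is invisible to \<open>signs\<close>, so any sequence of 1 and -1 is realized, in
  particular the powers of \<open>pattern\<close>.\<close>

lemma Phi_unbounded:
  assumes a: "a \<in> carrier A" "a \<noteq> \<one>\<^bsub>A\<^esub>" "sign a = 1"
    and c: "c \<in> carrier A" "c \<noteq> \<one>\<^bsub>A\<^esub>" "sign c = -1"
    and b: "b \<in> carrier B" "b \<noteq> \<one>\<^bsub>B\<^esub>"
  shows "\<exists>g \<in> carrier G. int n \<le> Phi g"
proof -
  define code where "code l = concat (map (\<lambda>i. [Inl (if i = 1 then a else c), Inr b]) l)"
    for l :: "int list"
  \<comment> \<open>That nonempty codes start in \<open>A\<close> is carried along, since each block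
    ends in \<open>b\<close>.\<close>
  have "reduced (code l) \<and> (code l = [] \<or> isl (hd (code l)))" for l
    by (induction l) (use a b c in \<open>auto simp: code_def reduced_Cons\<close>)
  then have red: "reduced (code l)" for l by blast
  have signs: "set l \<subseteq> {1, -1} \<Longrightarrow> signs (code l) = l" for l
    by (induction l) (use a c in \<open>auto simp: code_def\<close>)
  let ?l = "concat (replicate n pattern)"
  have words: "code ?l \<in> fp_words A B"
    using reduced_letters[OF red] by (auto simp: fp_words_def)
  have "signs (code ?l) = ?l"
    by (intro signs) (auto simp: pattern_def)
  then have "int n \<le> Phi (fp_rel A B `` {code ?l})"
    using chirality_pattern_power[of n] by (simp add: Phi_class[OF words] nf_reduced[OF red])
  then show ?thesis using fp_class_carrier[OF words] by blast
qed

end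

text \<open>Among two distinct nontrivial elements, either one differs from its inverse and is
  paired with it, or both are involutions.\<close>

lemma exists_signed_pair:
  assumes "group A" "infinite (carrier A) \<or> card (carrier A) \<ge> 3"
  obtains a c where "a \<in> carrier A - {\<one>\<^bsub>A\<^esub>}" "c \<in> carrier A - {\<one>\<^bsub>A\<^esub>}" "a \<noteq> c"
    "c = inv\<^bsub>A\<^esub> a \<or> inv\<^bsub>A\<^esub> a = a \<and> inv\<^bsub>A\<^esub> c = c"
proof -
  interpret A: group A by fact
  have "\<not> carrier A \<subseteq> {\<one>\<^bsub>A\<^esub>, x}" for x
    using assms(2) card_mono[of "{\<one>\<^bsub>A\<^esub>, x}" "carrier A"] finite_subset[of "carrier A" "{\<one>\<^bsub>A\<^esub>, x}"]
    by (auto simp: card_insert_if split: if_splits)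
  then obtain a c where ac: "a \<in> carrier A - {\<one>\<^bsub>A\<^esub>}" "c \<in> carrier A - {\<one>\<^bsub>A\<^esub>}" "a \<noteq> c"
    by (metis DiffI insert_iff singletonD subsetI)
  have "inv\<^bsub>A\<^esub> x \<in> carrier A - {\<one>\<^bsub>A\<^esub>}" if "x \<in> carrier A - {\<one>\<^bsub>A\<^esub>}" for x
    using that by auto
  then show thesis using that ac by metis
qed

theorem theorem1p3:
  fixes G1 :: "('a, 'c) monoid_scheme" and G2 :: "('b, 'd) monoid_scheme" and m :: nat
  assumes "group G1" and "group G2"
    and "infinite (carrier G1) \<or> card (carrier G1) \<ge> 3"
    and "infinite (carrier G2) \<or> card (carrier G2) \<ge> 2"
  defines "G \<equiv> free_product G1 G2"
    and "H1 \<equiv> fp_left G1 G2 ` carrier G1"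
    and "H2 \<equiv> fp_right G1 G2 ` carrier G2"
  shows "almost_palindromic_width m G (H1 \<union> H2) (fp_reduced_words G H1 H2) = \<infinity>"
proof -
  interpret G1: group G1 by fact
  interpret G2: group G2 by fact
  obtain a c where a: "a \<in> carrier G1 - {\<one>\<^bsub>G1\<^esub>}" and c: "c \<in> carrier G1 - {\<one>\<^bsub>G1\<^esub>}" and "a \<noteq> c"
    and inv: "c = inv\<^bsub>G1\<^esub> a \<or> inv\<^bsub>G1\<^esub> a = a \<and> inv\<^bsub>G1\<^esub> c = c"
    using exists_signed_pair[OF assms(1,3)] .
  have "\<not> carrier G2 \<subseteq> {\<one>\<^bsub>G2\<^esub>}"
    using assms(4) card_mono[of "{\<one>\<^bsub>G2\<^esub>}" "carrier G2"] finite_subset[of "carrier G2" "{\<one>\<^bsub>G2\<^esub>}"]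
    by auto
  then obtain b where b: "b \<in> carrier G2" "b \<noteq> \<one>\<^bsub>G2\<^esub>" by blast
  define sign :: "'a \<Rightarrow> int" where "sign x = (if x = a then 1 else if x = c then -1 else 0)" for x
  \<comment> \<open>As \<open>a\<close> and \<open>c\<close> differ, they cannot be mutually inverse
    and involutions at once, so this test identifies the case.\<close>
  define eps :: int where "eps = (if c = inv\<^bsub>G1\<^esub> a then -1 else 1)"
  interpret signed_two_groups G1 G2 sign eps
  proof
    show "eps = 1 \<or> eps = -1" by (simp add: eps_def)
    fix x assume x: "x \<in> carrier G1"
    have "inv\<^bsub>G1\<^esub> x = z \<longleftrightarrow> x = inv\<^bsub>G1\<^esub> z" if "z \<in> carrier G1" for z
      using x that by (metis G1.inv_inv)
    then have "inv\<^bsub>G1\<^esub> x = a \<longleftrightarrow> x = inv\<^bsub>G1\<^esub> a" "inv\<^bsub>G1\<^esub> x = c \<longleftrightarrow> x = inv\<^bsub>G1\<^esub> c"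
      using a c by auto
    then show "sign (inv\<^bsub>G1\<^esub> x) = eps * sign x"
      using a c \<open>a \<noteq> c\<close> inv by (auto simp: sign_def eps_def)
  qed
  have "sign a = 1" "sign c = -1" using \<open>a \<noteq> c\<close> by (auto simp: sign_def)
  then show ?thesis
    unfolding G_def H1_def H2_def
    using a b c by (intro almost_palindromic_width_infinite Phi_unbounded) auto
qed

end
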